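(* Let $G$ be a connected graph of order $n\ge 2$. Then $$1\le cfc(G)\le \alpha(G)\le n-1.$$ Moreover, $cfc(G)=1$ if and only if $\alpha(G)=1$, and $cfc(G)=n-1$ if and only if $\alpha(G)=n-1$.
   Context: All graphs are simple, finite and undirected; the order of a graph is its number of vertices. An edge-coloring of a graph is an arbitrary assignment of colors to its edges (not necessarily proper). An edge-colored graph $G$ is conflict-free connected if any two distinct vertices are connected by a path that contains at least one color used on exactly one of the edges of the path. The conflict-free connection number $cfc(G)$ of a connected graph $G$ is the minimum number of colors in an edge-coloring that makes $G$ conflict-free connected. $\alpha(G)$ denotes the independence number of $G$, i.e. the maximum cardinality of a set of pairwise non-adjacent vertices. *)

theory Defs
  imports "Graph_Theory.Pair_Digraph" "Graph_Theory.Digraph_Component" "Graph_Theory.Vertex_Walk"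
begin

text \<open>
  A finite simple undirected graph is a \<^locale>\<open>pair_graph\<close>: every undirected edge is a pair of
  opposite arcs. Colors live on the underlying two-element sets, so both orientations of an edge
  have the same color.
\<close>

definition edge_of :: "'a \<times> 'a \<Rightarrow> 'a set" where
  "edge_of a = {fst a, snd a}"

definition edges :: "'a pair_pre_digraph \<Rightarrow> 'a set set" where
  "edges G = edge_of ` parcs G"

definition path_edges :: "'a vwalk \<Rightarrow> 'a set set" where
  "path_edges p = edge_of ` set (vwalk_arcs p)"

definition conflict_free_path :: "('a set \<Rightarrow> nat) \<Rightarrow> 'a vwalk \<Rightarrow> bool" where
  "conflict_free_path c p \<longleftrightarrow> (\<exists>k. \<exists>!e. e \<in> path_edges p \<and> c e = k)"

definition conflict_free_connected :: "'a pair_pre_digraph \<Rightarrow> ('a set \<Rightarrow> nat) \<Rightarrow> bool" where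
  "conflict_free_connected G c \<longleftrightarrow>
     (\<forall>u\<in>pverts G. \<forall>v\<in>pverts G. u \<noteq> v \<longrightarrow>
        (\<exists>p. vpath p (with_proj G) \<and> hd p = u \<and> last p = v \<and> conflict_free_path c p))"

text \<open>
  Colors are natural numbers; only their values on the edges of the graph are counted.
\<close>

definition cfc :: "'a pair_pre_digraph \<Rightarrow> nat" where
  "cfc G = (LEAST k. \<exists>c. conflict_free_connected G c \<and> card (c ` edges G) = k)"

definition independent_set :: "'a pair_pre_digraph \<Rightarrow> 'a set \<Rightarrow> bool" where
  "independent_set G S \<longleftrightarrow> S \<subseteq> pverts G \<and> pairwise (\<lambda>u v. (u, v) \<notin> parcs G) S"

definition independence_number :: "'a pair_pre_digraph \<Rightarrow> nat" where
  "independence_number G = Max (card ` {S. independent_set G S})"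

end

theory Submission
  imports Defs
begin

text \<open>
  The upper bound is proved by induction over induced connected subgraphs. If a bridge has at least
  two vertices on each side, then each side has smaller independence number, so the bridge can be
  given a fresh color. Otherwise every bridge is pendant. Take an inclusion-minimal connected
  spanning edge set T; color the pendant edges with distinct colors 0, 1, ..., the remaining edges
  of T with 1 and all other edges with 0. Nonadjacent vertices are then handled by their T-path if one of
  them is a leaf whose color is not 1. Otherwise the first edge of the T-path is not a bridge, and
  exchanging it for another edge across the cut it defines yields a path with exactly one edge of
  color 0. Noncomplete graphs have at least two colors available for this.
\<close>

section \<open>Edges along a list of vertices\<close>

lemma path_edges_simps [simp]:
  "path_edges [] = {}"
  "path_edges [u] = {}"
  "path_edges (u # v # p) = insert {u, v} (path_edges (v # p))"
  by (auto simp: path_edges_def edge_of_def)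

lemma path_edges_append:
  assumes "p \<noteq> []" "q \<noteq> []"
  shows "path_edges (p @ q) = path_edges p \<union> insert {last p, hd q} (path_edges q)"
  using assms
proof (induction p rule: vwalk_arcs.induct)
  case (2 x)
  then show ?case by (cases q) auto
qed auto

lemma path_edges_subset: "e \<in> path_edges p \<Longrightarrow> e \<subseteq> set p"
  by (induction p rule: vwalk_arcs.induct) auto

text \<open>The edges to the predecessor and to the successor of \<open>x\<close> differ because the
  list is distinct. Consequently a vertex lying on only one edge can occur on a path only as one of
  its ends.\<close>

lemma interior_vertex_two_edges:
  assumes "distinct p" "x \<in> set p" "x \<noteq> hd p" "x \<noteq> last p"
  obtains e e' where "e \<in> path_edges p" "e' \<in> path_edges p" "x \<in> e" "x \<in> e'" "e \<noteq> e'"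
proof -
  obtain xs ys where p: "p = xs @ x # ys"
    using assms(2) by (meson split_list)
  have ne: "xs \<noteq> []" "ys \<noteq> []"
    using p assms(3,4) by auto
  have "path_edges p = path_edges xs \<union> insert {last xs, x} (path_edges (x # ys))"
    using path_edges_append[of xs "x # ys"] ne p by simp
  moreover have "path_edges (x # ys) = insert {x, hd ys} (path_edges ys)"
    using ne by (cases ys) auto
  moreover have "last xs \<in> set xs" "hd ys \<in> set ys"
    using ne by auto
  then have "{last xs, x} \<noteq> {x, hd ys}"
    using p assms(1) by (auto simp: doubleton_eq_iff)
  ultimately show thesis
    using that[of "{last xs, x}" "{x, hd ys}"] by blast
qed

section \<open>Paths and reachability inside a vertex set\<close>

definition path_in :: "'a set \<Rightarrow> 'a set set \<Rightarrow> 'a \<Rightarrow> 'a \<Rightarrow> 'a list \<Rightarrow> bool" where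
  "path_in W F u v p \<longleftrightarrow>
     p \<noteq> [] \<and> distinct p \<and> set p \<subseteq> W \<and> hd p = u \<and> last p = v \<and> path_edges p \<subseteq> F"

text \<open>Carrying \<open>W\<close> beside \<open>F\<close> lets induced subgraphs share one edge
  set: edges of \<open>F\<close> that are not contained in \<open>W\<close> may exist but are never
  traversed.\<close>

definition reaches :: "'a set \<Rightarrow> 'a set set \<Rightarrow> 'a \<Rightarrow> 'a \<Rightarrow> bool" where
  "reaches W F u v \<longleftrightarrow> (u, v) \<in> {(x, y). x \<in> W \<and> y \<in> W \<and> {x, y} \<in> F}\<^sup>*"

definition connected_on :: "'a set \<Rightarrow> 'a set set \<Rightarrow> bool" where
  "connected_on W F \<longleftrightarrow> (\<forall>u\<in>W. \<forall>v\<in>W. reaches W F u v)"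

lemma reaches_refl [simp, intro]: "reaches W F u u"
  by (simp add: reaches_def)

lemma reaches_step: "x \<in> W \<Longrightarrow> y \<in> W \<Longrightarrow> {x, y} \<in> F \<Longrightarrow> reaches W F x y"
  by (auto simp: reaches_def)

lemma reaches_trans [trans]: "reaches W F u v \<Longrightarrow> reaches W F v w \<Longrightarrow> reaches W F u w"
  by (auto simp: reaches_def)

lemma reaches_induct [consumes 1, case_names base step]:
  assumes "reaches W F u v" and "P u"
    and "\<And>x y. reaches W F u x \<Longrightarrow> x \<in> W \<Longrightarrow> y \<in> W \<Longrightarrow> {x, y} \<in> F \<Longrightarrow> P x \<Longrightarrow> P y"
  shows "P v"
  using assms(1) unfolding reaches_def
proof (induction rule: rtrancl_induct)
  case base
  then show ?case using assms(2) .
next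
  case (step y z)
  then show ?case using assms(3)[of y z] by (auto simp: reaches_def)
qed

lemma reaches_sym: "reaches W F u v \<Longrightarrow> reaches W F v u"
proof (induction rule: reaches_induct)
  case (step x y)
  then have "reaches W F y x" by (intro reaches_step) (auto simp: insert_commute)
  then show ?case using step.IH by (rule reaches_trans)
qed (rule reaches_refl)

text \<open>Induction along the walk: if the next vertex already lies on the path built so far, the
  path is cut back to that vertex; otherwise the vertex is appended.\<close>

lemma path_in_of_reaches:
  assumes "reaches W F u v" "u \<in> W"
  obtains p where "path_in W F u v p"
proof -
  have "\<exists>p. path_in W F u v p"
    using assms(1)
  proof (induction rule: reaches_induct)
    case base
    show ?case using assms(2) by (intro exI[of _ "[u]"]) (simp add: path_in_def)
  next
    case (step x y)
    then obtain p where p: "path_in W F u x p" by blast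
    show ?case
    proof (cases "y \<in> set p")
      case True
      then obtain xs ys where eq: "p = xs @ y # ys" by (meson split_list)
      have "path_edges (xs @ [y]) \<subseteq> path_edges p"
        using path_edges_append[of "xs @ [y]" ys] eq by (cases "ys = []") auto
      then have "path_in W F u y (xs @ [y])"
        using p eq by (cases xs) (auto simp: path_in_def)
      then show ?thesis by blast
    next
      case False
      then have "path_in W F u y (p @ [y])"
        using p step by (auto simp: path_in_def path_edges_append)
      then show ?thesis by blast
    qed
  qed
  then show thesis using that by blast
qed

lemma reaches_of_path_in:
  assumes "path_in W F u v p"
  shows "reaches W F u v"
  using assms
proof (induction p arbitrary: u rule: vwalk_arcs.induct)
  case (3 x y xs)
  then have "path_in W F y v (y # xs)" "reaches W F u y"
    by (auto simp: path_in_def intro: reaches_step)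
  then show ?case using 3 reaches_trans by metis
qed (auto simp: path_in_def)

lemma path_in_mono: "path_in W F u v p \<Longrightarrow> W \<subseteq> W' \<Longrightarrow> F \<subseteq> F' \<Longrightarrow> path_in W' F' u v p"
  by (auto simp: path_in_def)

lemma path_in_join:
  assumes "path_in A F u x p" "path_in B F y v q" "A \<inter> B = {}"
    and "A \<subseteq> W" "B \<subseteq> W" "F \<subseteq> F'" "{x, y} \<in> F'"
  shows "path_in W F' u v (p @ q)"
    and "path_edges (p @ q) = insert {x, y} (path_edges p \<union> path_edges q)"
  using assms by (auto simp: path_in_def path_edges_append)

section \<open>Spanning trees, as inclusion-minimal connecting edge sets, and their cuts\<close>

lemma minimal_connected:
  assumes "finite F" "connected_on W F"
  shows "\<exists>T \<subseteq> F. connected_on W T \<and> (\<forall>f \<in> T. \<not> connected_on W (T - {f}))"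
  using assms
proof (induction F rule: finite_psubset_induct)
  case (psubset F)
  show ?case
  proof (cases "\<exists>f \<in> F. connected_on W (F - {f})")
    case True
    then obtain f where "f \<in> F" "connected_on W (F - {f})" by blast
    then show ?thesis using psubset.IH[of "F - {f}"] by blast
  qed (use psubset in blast)
qed

text \<open>Deleting an edge of a minimal connecting set leaves exactly two components, one around
  each end. A walk from \<open>a\<close> restarts at \<open>a\<close> or \<open>b\<close> whenever
  it uses the deleted edge, so every vertex is reached from one of them; a vertex reached from both
  would reconnect everything.\<close>

lemma connected_on_remove_edge:
  assumes conn: "connected_on W T" and ab: "a \<in> W" "b \<in> W"
    and nconn: "\<not> connected_on W (T - {{a, b}})"
  shows "z \<in> W \<Longrightarrow> reaches W (T - {{a, b}}) a z \<or> reaches W (T - {{a, b}}) b z"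
    and "\<not> (reaches W (T - {{a, b}}) a z \<and> reaches W (T - {{a, b}}) b z)"
proof -
  let ?R = "reaches W (T - {{a, b}})"
  have *: "?R a z \<or> ?R b z" if "z \<in> W" for z
  proof -
    have "reaches W T a z" using conn ab that by (auto simp: connected_on_def)
    then show ?thesis
    proof (induction rule: reaches_induct)
      case (step x y)
      show ?case
      proof (cases "{x, y} = {a, b}")
        case True
        then show ?thesis by (auto simp: doubleton_eq_iff)
      next
        case False
        then have "?R x y" using step by (intro reaches_step) auto
        then show ?thesis using step reaches_trans by metis
      qed
    qed auto
  qed
  then show "z \<in> W \<Longrightarrow> ?R a z \<or> ?R b z" .
  show "\<not> (?R a z \<and> ?R b z)"
  proof
    assume "?R a z \<and> ?R b z"
    then have "?R a b" by (meson reaches_sym reaches_trans)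
    then have "?R a y" if "y \<in> W" for y using * that reaches_trans by metis
    then have "connected_on W (T - {{a, b}})"
      unfolding connected_on_def by (meson reaches_sym reaches_trans)
    then show False using nconn by blast
  qed
qed

text \<open>All edges across the cut meet \<open>A\<close> in the same vertex \<open>x\<close>, so a
  walk that leaves \<open>A\<close> does so at \<open>x\<close> and comes back at \<open>x\<close>.
  Its excursions into \<open>B\<close> can be cut out.\<close>

lemma connected_on_side:
  assumes conn: "connected_on W F" and W: "A \<union> B = W" "A \<inter> B = {}" and x: "x \<in> A"
    and one: "\<And>e. e \<in> F \<Longrightarrow> e \<subseteq> W \<Longrightarrow> e \<inter> A \<noteq> {} \<Longrightarrow> e \<inter> B \<noteq> {} \<Longrightarrow> e \<inter> A = {x}"
  shows "connected_on A F"
  unfolding connected_on_def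
proof (intro ballI)
  fix u v assume u: "u \<in> A" and v: "v \<in> A"
  then have "reaches W F u v" using conn W by (auto simp: connected_on_def)
  \<comment> \<open>While the walk is in \<open>B\<close>, the invariant records that its exit point
    \<open>x\<close> is reachable inside \<open>A\<close>; a return to \<open>A\<close> lands on
    \<open>x\<close> again.\<close>
  then have "(v \<in> A \<longrightarrow> reaches A F u v) \<and> (v \<in> B \<longrightarrow> reaches A F u x)"
  proof (induction rule: reaches_induct)
    case base
    then show ?case using u W by auto
  next
    case (step y z)
    consider "y \<in> A" "z \<in> A" | "y \<in> A" "z \<in> B" | "y \<in> B" "z \<in> A" | "y \<in> B" "z \<in> B"
      using step W by blast
    then show ?case
    proof cases
      case 1
      then have "reaches A F y z" using step by (intro reaches_step) auto
      then show ?thesis using 1 step W reaches_trans by fast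
    next
      case 2
      then have "{y, z} \<inter> A = {y}" using W by auto
      then have "y = x" using one[of "{y, z}"] 2 step by auto
      then show ?thesis using 2 step W by auto
    next
      case 3
      then have "{y, z} \<inter> A = {z}" using W by auto
      then have "z = x" using one[of "{y, z}"] 3 step by auto
      then show ?thesis using 3 step W by auto
    next
      case 4
      then show ?thesis using step W by auto
    qed
  qed
  then show "reaches A F u v" using v by blast
qed

lemma connected_on_path:
  assumes "connected_on W F" "u \<in> W" "v \<in> W"
  obtains p where "path_in W F u v p"
  using path_in_of_reaches[OF bspec[OF bspec[OF assms(1)[unfolded connected_on_def] assms(2)] assms(3)] assms(2)] .

text \<open>The edge \<open>{u, w}\<close> is the first one on the \<open>T\<close>-path from
  \<open>u\<close> to \<open>v\<close>, and \<open>A\<close> and \<open>B\<close> are the components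
  of \<open>T\<close> without it. The rest of the path avoids \<open>u\<close>, hence avoids this
  edge, which puts \<open>v\<close> on the side of \<open>w\<close>.\<close>

lemma tree_edge_cut:
  assumes T: "connected_on W T" "\<forall>f\<in>T. \<not> connected_on W (T - {f})"
    and wf: "\<And>e. e \<in> T \<Longrightarrow> e \<subseteq> W \<and> card e = 2"
    and uv: "u \<in> W" "v \<in> W" "u \<noteq> v"
  obtains w A B where "{u, w} \<in> T" "A \<union> B = W" "A \<inter> B = {}" "u \<in> A" "w \<in> B" "v \<in> B"
    "connected_on A T" "connected_on B T"
    "\<forall>e\<in>T. e \<inter> A \<noteq> {} \<longrightarrow> e \<inter> B \<noteq> {} \<longrightarrow> e = {u, w}"
proof -
  obtain p where p: "path_in W T u v p"
    using connected_on_path[OF T(1) uv(1,2)] .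
  obtain w q where pq: "p = u # w # q"
  proof -
    obtain q' where "p = u # q'" using p by (cases p) (auto simp: path_in_def)
    moreover have "q' \<noteq> []" using p calculation uv by (auto simp: path_in_def)
    ultimately show thesis using that by (cases q') auto
  qed
  let ?f = "{u, w}"
  let ?R = "reaches W (T - {?f})"
  define A where "A = {z \<in> W. ?R u z}"
  define B where "B = {z \<in> W. ?R w z}"
  have f: "?f \<in> T" "w \<in> W" using p pq by (auto simp: path_in_def)
  have AB: "A \<union> B = W" "A \<inter> B = {}"
    using connected_on_remove_edge[OF T(1) uv(1) f(2) T(2)[rule_format, OF f(1)]]
    unfolding A_def B_def by blast+
  have "path_in W (T - {?f}) w v (w # q)"
  proof -
    have "u \<notin> set (w # q)" using p pq by (auto simp: path_in_def)
    then have "?f \<notin> path_edges (w # q)" using path_edges_subset by fast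
    then show ?thesis using p pq by (auto simp: path_in_def)
  qed
  then have "?R w v" by (rule reaches_of_path_in)
  then have "v \<in> B" using uv by (simp add: B_def)
  \<comment> \<open>Another edge of \<open>T\<close> across the cut would survive the deletion and
    join the two components.\<close>
  have cut: "e = ?f" if e: "e \<in> T" "e \<inter> A \<noteq> {}" "e \<inter> B \<noteq> {}" for e
  proof (rule ccontr)
    assume ne: "e \<noteq> ?f"
    obtain s t where st: "e = {s, t}" using wf[OF e(1)] by (auto simp: card_2_iff)
    with e AB have "s \<in> A \<and> t \<in> B \<or> s \<in> B \<and> t \<in> A" by auto
    moreover have "?R s t" using st e ne wf[OF e(1)] by (intro reaches_step) auto
    moreover from this have "?R t s" by (rule reaches_sym)
    moreover have "s \<in> W" "t \<in> W" using st wf[OF e(1)] by auto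
    moreover have "x \<in> A" if "x \<in> W" "y \<in> A" "?R y x" for x y
    proof -
      have "?R u y" using that(2) by (simp add: A_def)
      then have "?R u x" using that(3) by (rule reaches_trans)
      then show ?thesis using that(1) by (simp add: A_def)
    qed
    ultimately show False using AB by blast
  qed
  have uw: "u \<in> A" "w \<in> B" using uv f unfolding A_def B_def by auto
  then have "{u, w} \<inter> A = {u}" "{u, w} \<inter> B = {w}" using AB by auto
  then have ends: "e \<inter> A = {u}" "e \<inter> B = {w}" if "e \<in> T" "e \<inter> A \<noteq> {}" "e \<inter> B \<noteq> {}" for e
    using cut[OF that] by blast+
  have "connected_on A T"
    using connected_on_side[OF T(1) AB uw(1)] ends(1) by blast
  moreover have "connected_on B T"
    using connected_on_side[OF T(1), of B A w] AB uw(2) ends(2) by (metis Int_commute Un_commute)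
  ultimately show thesis
    by (intro that[OF f(1) AB uw \<open>v \<in> B\<close>]) (simp_all add: cut)
qed

section \<open>Coloring a graph all of whose bridges are pendant\<close>

lemma conflict_free_pathI:
  assumes "e \<in> path_edges p" "\<And>e'. e' \<in> path_edges p \<Longrightarrow> c e' = c e \<Longrightarrow> e' = e"
  shows "conflict_free_path c p"
  using assms unfolding conflict_free_path_def by (intro exI[of _ "c e"]) blast

definition leaves :: "'a set \<Rightarrow> 'a set set \<Rightarrow> 'a set" where
  "leaves W F = {v \<in> W. \<exists>!e. e \<in> F \<and> v \<in> e}"

lemma leaf_edge_unique: "x \<in> leaves W F \<Longrightarrow> e \<in> F \<Longrightarrow> e' \<in> F \<Longrightarrow> x \<in> e \<Longrightarrow> x \<in> e' \<Longrightarrow> e = e'"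
  unfolding leaves_def by blast

lemma path_edges_rev:
  "path_edges (rev p) = path_edges p"
proof (induction p rule: vwalk_arcs.induct)
  case (3 x y xs)
  then show ?case using path_edges_append[of "rev xs @ [y]" "[x]"] by auto
qed auto

lemma path_in_rev: "path_in W F u v p \<Longrightarrow> path_in W F v u (rev p)"
  by (auto simp: path_in_def path_edges_rev hd_rev last_rev)

definition cf_connected_on :: "'a set \<Rightarrow> 'a set set \<Rightarrow> ('a set \<Rightarrow> nat) \<Rightarrow> bool" where
  "cf_connected_on W E c \<longleftrightarrow>
     (\<forall>u\<in>W. \<forall>v\<in>W. u \<noteq> v \<longrightarrow> (\<exists>p. path_in W E u v p \<and> conflict_free_path c p))"

text \<open>A bridge is encoded as the only edge across a bipartition instead of through edge
  deletion. This is the form in which cuts are supplied by \<open>tree_edge_cut\<close> and consumed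
  by \<open>connected_on_side\<close>.\<close>

definition bridges_pendant :: "'a set \<Rightarrow> 'a set set \<Rightarrow> bool" where
  "bridges_pendant W F \<longleftrightarrow> (\<forall>A B f. A \<union> B = W \<longrightarrow> A \<inter> B = {} \<longrightarrow> f \<in> F \<longrightarrow>
     f \<inter> A \<noteq> {} \<longrightarrow> f \<inter> B \<noteq> {} \<longrightarrow> (\<forall>e\<in>F. e \<inter> A \<noteq> {} \<longrightarrow> e \<inter> B \<noteq> {} \<longrightarrow> e = f) \<longrightarrow>
     (\<exists>x. A = {x} \<or> B = {x}))"

text \<open>The maximum with 2 makes room for the colors 0 and 1 when there are fewer than two
  leaves. As no edge joins two leaves, each pendant edge has a single leaf, which determines its
  color.\<close>

lemma cf_coloring_pendant_bridges:
  assumes W: "finite W" and F: "connected_on W F"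
    and wf: "\<And>e. e \<in> F \<Longrightarrow> e \<subseteq> W \<and> card e = 2"
    and pendant: "bridges_pendant W F"
    and indep: "\<And>e. e \<in> F \<Longrightarrow> \<not> e \<subseteq> leaves W F"
  shows "\<exists>c. (\<forall>e\<in>F. c e < max 2 (card (leaves W F))) \<and> cf_connected_on W F c"
proof -
  let ?L = "leaves W F"
  have "F \<subseteq> Pow W" using wf by auto
  then have "finite F" using W by (simp add: finite_subset)
  obtain T where T: "T \<subseteq> F" "connected_on W T" "\<forall>f\<in>T. \<not> connected_on W (T - {f})"
    using minimal_connected[OF \<open>finite F\<close> F] by (elim exE conjE)
  have wfT: "\<And>e. e \<in> T \<Longrightarrow> e \<subseteq> W \<and> card e = 2" using wf T by blast
  have LW: "?L \<subseteq> W" by (auto simp: leaves_def)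
  then have "finite ?L" using W finite_subset by blast
  \<comment> \<open>Numbering starts at 0, so at most one leaf has index 1, the color that is shared
    with the tree edges.\<close>
  then obtain idx :: "'a \<Rightarrow> nat" where idx: "bij_betw idx ?L {0..<card ?L}"
    using ex_bij_betw_finite_nat by blast
  \<comment> \<open>Leaves are those of \<open>F\<close>, not of the tree \<open>T\<close>. The
    choice by \<open>SOME\<close> is unambiguous on edges of \<open>F\<close>, as
    \<open>c_leaf\<close> shows.\<close>
  define c where "c e = (if e \<inter> ?L \<noteq> {} then idx (SOME x. x \<in> e \<inter> ?L) else if e \<in> T then 1 else 0)"
    for e
  have c_leaf: "c e = idx x" if "e \<in> F" "x \<in> e" "x \<in> ?L" for e x
  proof -
    obtain s t where st: "e = {s, t}" using wf[OF \<open>e \<in> F\<close>] by (auto simp: card_2_iff)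
    then have "e \<inter> ?L = {x}"
      using indep[OF \<open>e \<in> F\<close>] \<open>x \<in> e\<close> \<open>x \<in> ?L\<close> by auto
    then show ?thesis by (simp add: c_def)
  qed
  have c_nonleaf: "c e = (if e \<in> T then 1 else 0)" if "e \<inter> ?L = {}" for e
    using that by (simp add: c_def)
  have idx_less: "idx x < card ?L" if "x \<in> ?L" for x
    using bij_betwE[OF idx] that by simp
  have idx_inj: "x = y" if "x \<in> ?L" "y \<in> ?L" "idx x = idx y" for x y
    using inj_onD[OF bij_betw_imp_inj_on[OF idx] that(3,1,2)] .
  have bound: "c e < max 2 (card ?L)" if e: "e \<in> F" for e
  proof (cases "e \<inter> ?L = {}")
    case True
    then have "c e < 2" using c_nonleaf[of e] by simp
    then show ?thesis by simp
  next
    case False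
    then obtain x where "x \<in> e" "x \<in> ?L" by blast
    then have "c e < card ?L" using c_leaf[OF e] idx_less by simp
    then show ?thesis by simp
  qed

  \<comment> \<open>On the \<open>T\<close>-path all edges without a leaf have color 1, and distinct
    leaves give distinct colors. Hence the color of the pendant edge at \<open>u\<close> does not
    recur.\<close>
  have leaf_case: "\<exists>p. path_in W F u v p \<and> conflict_free_path c p"
    if uv: "u \<in> W" "v \<in> W" "u \<noteq> v" and u: "u \<in> ?L" "idx u \<noteq> 1" for u v
  proof -
    obtain p where p: "path_in W T u v p"
      using connected_on_path[OF T(2) uv(1,2)] .
    obtain f where f: "f \<in> path_edges p" "u \<in> f"
    proof -
      obtain q where q: "p = u # q" using p by (cases p) (auto simp: path_in_def)
      then have "q \<noteq> []" using p uv by (auto simp: path_in_def)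
      then show thesis using that q by (cases q) auto
    qed
    have pF: "path_edges p \<subseteq> F" "path_edges p \<subseteq> T" using p T(1) by (auto simp: path_in_def)
    have "conflict_free_path c p"
    proof (rule conflict_free_pathI[OF f(1)])
      fix g assume g: "g \<in> path_edges p" "c g = c f"
      then have cg: "c g = idx u" using c_leaf f u pF by auto
      have "g \<inter> ?L \<noteq> {}" using c_nonleaf[of g] g pF cg u(2) by auto
      then obtain x where x: "x \<in> g" "x \<in> ?L" by blast
      then have "x = u" using c_leaf g pF cg idx_inj u(1) by auto
      then show "g = f" using leaf_edge_unique[OF u(1)] g f pF x by blast
    qed
    then show ?thesis using path_in_mono[OF p order_refl T(1)] by blast
  qed

  \<comment> \<open>The path sought has exactly one edge of color 0, an edge outside
    \<open>T\<close>. The conditions on \<open>u\<close> and \<open>v\<close> keep the leaf of index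
    0 from being an end of it.\<close>
  have nonleaf_case: "\<exists>p. path_in W F u v p \<and> conflict_free_path c p"
    if uv: "u \<in> W" "v \<in> W" "u \<noteq> v" and u: "u \<notin> ?L" and v: "v \<in> ?L \<Longrightarrow> idx v = 1" for u v
  proof (cases "{u, v} \<in> F")
    case True
    then have "path_in W F u v [u, v]" using uv by (auto simp: path_in_def)
    moreover have "conflict_free_path c [u, v]" by (rule conflict_free_pathI[of "{u, v}"]) auto
    ultimately show ?thesis by blast
  next
    case False
    obtain w A B where cut: "{u, w} \<in> T" "A \<union> B = W" "A \<inter> B = {}" "u \<in> A" "w \<in> B" "v \<in> B"
      and conn: "connected_on A T" "connected_on B T"
      and only: "\<forall>e\<in>T. e \<inter> A \<noteq> {} \<longrightarrow> e \<inter> B \<noteq> {} \<longrightarrow> e = {u, w}"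
      by (rule tree_edge_cut[OF T(2,3) wfT uv])
    have fF: "{u, w} \<in> F" using cut T by blast
    \<comment> \<open>If \<open>{u, w}\<close> were the only edge between A and B, it would be pendant at \<open>u\<close>.\<close>
    have "\<exists>e \<in> F. e \<inter> A \<noteq> {} \<and> e \<inter> B \<noteq> {} \<and> e \<noteq> {u, w}"
    proof (rule ccontr)
      assume "\<not> ?thesis"
      then have only': "\<And>e. e \<in> F \<Longrightarrow> e \<inter> A \<noteq> {} \<Longrightarrow> e \<inter> B \<noteq> {} \<Longrightarrow> e = {u, w}" by blast
      then have "\<exists>x. A = {x} \<or> B = {x}"
        using pendant[unfolded bridges_pendant_def, rule_format, OF cut(2,3) fF] cut by blast
      \<comment> \<open>Since \<open>u\<close> and \<open>v\<close> are nonadjacent,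
        \<open>B\<close> contains the two different vertices \<open>w\<close> and \<open>v\<close>,
        so the singleton side is \<open>A\<close>.\<close>
      moreover have "w \<noteq> v" using False fF by auto
      ultimately have A: "A = {u}" using cut by auto
      have "e = {u, w}" if "e \<in> F" "u \<in> e" for e
      proof (rule only'[OF that(1)])
        show "e \<inter> A \<noteq> {}" using that cut by auto
        obtain s t where "e = {s, t}" "s \<noteq> t" using wf[OF \<open>e \<in> F\<close>] by (auto simp: card_2_iff)
        then show "e \<inter> B \<noteq> {}" using wf[OF that(1)] cut A by auto
      qed
      then have "u \<in> ?L" using uv fF unfolding leaves_def by auto
      then show False using u by blast
    qed
    then obtain e where e: "e \<in> F" "e \<inter> A \<noteq> {}" "e \<inter> B \<noteq> {}" "e \<noteq> {u, w}" by blast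
    then have eT: "e \<notin> T" using only by blast
    obtain s t where st: "e = {s, t}" "s \<in> A" "t \<in> B"
    proof -
      obtain a b where "e = {a, b}" using wf[OF e(1)] by (auto simp: card_2_iff)
      then show thesis using that[of a b] that[of b a] e cut by auto
    qed
    \<comment> \<open>Exchange: follow \<open>T\<close> inside \<open>A\<close> from
      \<open>u\<close> to \<open>s\<close>, cross by \<open>e\<close> instead of
      \<open>{u, w}\<close>, then follow \<open>T\<close> inside \<open>B\<close> from
      \<open>t\<close> to \<open>v\<close>.\<close>
    obtain p where p: "path_in A T u s p"
      using connected_on_path[OF conn(1) cut(4) st(2)] .
    obtain q where q: "path_in B T t v q"
      using connected_on_path[OF conn(2) st(3) cut(6)] .
    have pq: "path_in W F u v (p @ q)"
      using path_in_join(1)[OF p q cut(3), of W F] cut T st e by auto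
    have edges: "path_edges (p @ q) = insert e (path_edges p \<union> path_edges q)"
      using path_in_join(2)[OF p q cut(3), of W F] cut T st e by auto
    \<comment> \<open>Some edge of \<open>T\<close> contains each leaf, and it is the leaf's only
      edge in \<open>F\<close>. So the pendant edges all belong to \<open>T\<close>, while
      \<open>e\<close> does not.\<close>
    have "x \<notin> ?L" if "x \<in> e" for x
    proof
      assume x: "x \<in> ?L"
      have "\<exists>y. y \<in> W \<and> y \<noteq> x" using uv by metis
      then obtain y where y: "y \<in> W" "x \<noteq> y" by blast
      have "x \<in> W" using x LW by auto
      have "\<exists>z. {x, z} \<in> T"
        by (rule tree_edge_cut[OF T(2,3) wfT \<open>x \<in> W\<close> y]) auto
      then obtain z where "{x, z} \<in> T" ..
      then have "e = {x, z}" using leaf_edge_unique[OF x e(1)] T(1) that by blast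
      then show False using eT \<open>{x, z} \<in> T\<close> by simp
    qed
    then have ce: "c e = 0" using c_nonleaf[of e] eT by auto
    have "conflict_free_path c (p @ q)"
    proof (rule conflict_free_pathI[of e])
      show "e \<in> path_edges (p @ q)" using edges by simp
      fix g assume g: "g \<in> path_edges (p @ q)" "c g = c e"
      show "g = e"
      proof (rule ccontr)
        assume "g \<noteq> e"
        then have gT: "g \<in> T" using g edges p q by (auto simp: path_in_def)
        then obtain x where x: "x \<in> g" "x \<in> ?L" using c_nonleaf[of g] g ce by (auto split: if_splits)
        \<comment> \<open>A second edge of color 0 would be pendant at the leaf of index 0. That
          leaf is neither \<open>u\<close> nor \<open>v\<close>, so it would be interior to the path
          and lie on two edges.\<close>
        have "idx x = 0" using c_leaf[of g x] x gT T(1) g ce by auto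
        then have "x \<noteq> u" "x \<noteq> v" using u v x by auto
        then obtain e1 e2 where "e1 \<in> path_edges (p @ q)" "e2 \<in> path_edges (p @ q)"
          "x \<in> e1" "x \<in> e2" "e1 \<noteq> e2"
          using interior_vertex_two_edges[of "p @ q" x] pq x path_edges_subset[OF g(1)]
          unfolding path_in_def by blast
        then show False using leaf_edge_unique[OF x(2)] pq unfolding path_in_def by blast
      qed
    qed
    then show ?thesis using pq by blast
  qed

  have symm: "\<exists>p. path_in W F u v p \<and> conflict_free_path c p"
    if ex: "\<exists>p. path_in W F v u p \<and> conflict_free_path c p" for u v
  proof -
    obtain p where p: "path_in W F v u p" "conflict_free_path c p" using ex by blast
    then have "conflict_free_path c (rev p)"
      by (simp add: conflict_free_path_def path_edges_rev)
    then show ?thesis using path_in_rev[OF p(1)] by blast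
  qed
  have "\<exists>p. path_in W F u v p \<and> conflict_free_path c p" if uv: "u \<in> W" "v \<in> W" "u \<noteq> v" for u v
  proof -
    \<comment> \<open>If neither end is a leaf of index other than 1, the ends cannot both be
      leaves, since index 1 occurs only once.\<close>
    consider "u \<in> ?L" "idx u \<noteq> 1" | "v \<in> ?L" "idx v \<noteq> 1"
      | "u \<notin> ?L" "v \<in> ?L \<longrightarrow> idx v = 1" | "v \<notin> ?L" "u \<in> ?L \<longrightarrow> idx u = 1"
      using uv idx_inj[of u v] by fastforce
    then show ?thesis
    proof cases
      case 1
      then show ?thesis using leaf_case[of u v] uv by simp
    next
      case 2
      then show ?thesis using symm[OF leaf_case[of v u]] uv by simp
    next
      case 3
      then show ?thesis using nonleaf_case[of u v] uv by simp
    next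
      case 4
      then show ?thesis using symm[OF nonleaf_case[of v u]] uv by simp
    qed
  qed
  then have "cf_connected_on W F c" unfolding cf_connected_on_def by blast
  then show ?thesis using bound by blast
qed

section \<open>Independence numbers of induced subgraphs\<close>

definition alpha :: "'a set \<Rightarrow> 'a set set \<Rightarrow> nat" where
  "alpha W E = Max (card ` {S. S \<subseteq> W \<and> (\<forall>e\<in>E. \<not> e \<subseteq> S)})"

lemma card_le_alpha:
  assumes "finite W" "S \<subseteq> W" "\<And>e. e \<in> E \<Longrightarrow> \<not> e \<subseteq> S"
  shows "card S \<le> alpha W E"
  unfolding alpha_def using assms by (intro Max_ge) auto

lemma alpha_attained:
  assumes "finite W" "\<And>e. e \<in> E \<Longrightarrow> card e = 2"
  obtains S where "S \<subseteq> W" "\<forall>e\<in>E. \<not> e \<subseteq> S" "card S = alpha W E"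
proof -
  have "alpha W E \<in> card ` {S. S \<subseteq> W \<and> (\<forall>e\<in>E. \<not> e \<subseteq> S)}"
    unfolding alpha_def
  proof (rule Max_in)
    have "{} \<in> {S. S \<subseteq> W \<and> (\<forall>e\<in>E. \<not> e \<subseteq> S)}" using assms(2) by force
    then show "card ` {S. S \<subseteq> W \<and> (\<forall>e\<in>E. \<not> e \<subseteq> S)} \<noteq> {}" by blast
  qed (use assms(1) in simp)
  then show thesis using that by (auto simp: image_iff)
qed

text \<open>A nonadjacent pair is an independent set of size 2. The inequality, rather than an
  equation, also covers empty \<open>W\<close>, where the value is 0.\<close>

lemma alpha_le_one_iff:
  assumes "finite W" "\<And>e. e \<in> E \<Longrightarrow> card e = 2"
  shows "alpha W E \<le> 1 \<longleftrightarrow> (\<forall>u\<in>W. \<forall>v\<in>W. u \<noteq> v \<longrightarrow> {u, v} \<in> E)"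
proof (intro iffI ballI impI)
  fix u v assume a: "alpha W E \<le> 1" "u \<in> W" "v \<in> W" "u \<noteq> v"
  show "{u, v} \<in> E"
  proof (rule ccontr)
    assume "{u, v} \<notin> E"
    moreover have "e = {u, v}" if "e \<in> E" "e \<subseteq> {u, v}" for e
      using card_subset_eq[of "{u, v}" e] assms(2)[OF that(1)] that(2) a(4) by simp
    ultimately have "card {u, v} \<le> alpha W E"
      using a by (intro card_le_alpha[OF assms(1)]) auto
    then show False using a by simp
  qed
next
  assume a: "\<forall>u\<in>W. \<forall>v\<in>W. u \<noteq> v \<longrightarrow> {u, v} \<in> E"
  obtain S where S: "S \<subseteq> W" "\<forall>e\<in>E. \<not> e \<subseteq> S" "card S = alpha W E"
    using alpha_attained[OF assms] .
  have "u = v" if "u \<in> S" "v \<in> S" for u v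
    using a S(1,2) that by (meson empty_subsetI insert_subset subsetD)
  then have "card S \<le> 1"
    using assms(1) S(1) by (simp add: card_le_Suc0_iff_eq finite_subset)
  then show "alpha W E \<le> 1" using S(3) by simp
qed

text \<open>Every edge across the cut meets \<open>B\<close> only in \<open>y\<close>, so
  \<open>z\<close> has no neighbor in \<open>A\<close> and can be added to a maximum independent set
  of \<open>A\<close>.\<close>

lemma alpha_side:
  assumes W: "finite W" "A \<union> B = W" "A \<inter> B = {}" and E: "\<And>e. e \<in> E \<Longrightarrow> card e = 2"
    and one: "\<And>e. e \<in> E \<Longrightarrow> e \<subseteq> W \<Longrightarrow> e \<inter> A \<noteq> {} \<Longrightarrow> e \<inter> B \<noteq> {} \<Longrightarrow> e \<inter> B = {y}"
    and z: "z \<in> B" "z \<noteq> y"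
  shows "alpha A E < alpha W E"
proof -
  have "finite A" using W by auto
  obtain S where S: "S \<subseteq> A" "\<forall>e\<in>E. \<not> e \<subseteq> S" "card S = alpha A E"
    using alpha_attained[OF \<open>finite A\<close> E] .
  have "z \<notin> S" using S z W by auto
  have "\<not> e \<subseteq> insert z S" if e: "e \<in> E" for e
  proof
    assume sub: "e \<subseteq> insert z S"
    then have "z \<in> e" using S(2) e by auto
    moreover have "e \<noteq> {z}" using E[OF e] by auto
    ultimately have "e \<inter> A \<noteq> {}" "e \<inter> B \<noteq> {}" using sub S(1) z by auto
    moreover have "e \<subseteq> W" using sub S(1) z W by auto
    ultimately have "e \<inter> B = {y}" using one e by blast
    then show False using z \<open>z \<in> e\<close> by auto
  qed
  then have "card (insert z S) \<le> alpha W E"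
    using S z W by (intro card_le_alpha) auto
  then show ?thesis using S(1,3) \<open>z \<notin> S\<close> \<open>finite A\<close> finite_subset[of S A] by simp
qed

section \<open>Gluing two colorings along a bridge\<close>

lemma conflict_free_path_cong:
  "(\<And>e. e \<in> path_edges p \<Longrightarrow> c e = c' e) \<Longrightarrow> conflict_free_path c p \<longleftrightarrow> conflict_free_path c' p"
  by (simp add: conflict_free_path_def cong: conj_cong)

lemma conflict_free_path_rev: "conflict_free_path c (rev p) \<longleftrightarrow> conflict_free_path c p"
  by (simp add: conflict_free_path_def path_edges_rev)

lemma path_in_edges: "path_in W E u v p \<Longrightarrow> e \<in> path_edges p \<Longrightarrow> e \<in> E \<and> e \<subseteq> W"
  using path_edges_subset[of e p] by (auto simp: path_in_def)

text \<open>Both sides may reuse the same colors below \<open>k\<close>. Paths within a side keep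
  their old coloring, and a path between the sides is routed through \<open>{x, y}\<close>, its only
  edge of color \<open>k\<close>.\<close>

lemma cf_coloring_glue:
  assumes AB: "A \<inter> B = {}"
    and E: "\<And>e. e \<in> E \<Longrightarrow> card e = 2"
    and xy: "x \<in> A" "y \<in> B" "{x, y} \<in> E" and conn: "connected_on A E" "connected_on B E"
    and cA: "\<And>e. e \<in> E \<Longrightarrow> e \<subseteq> A \<Longrightarrow> cA e < k" "cf_connected_on A E cA"
    and cB: "\<And>e. e \<in> E \<Longrightarrow> e \<subseteq> B \<Longrightarrow> cB e < k" "cf_connected_on B E cB"
  shows "\<exists>c. (\<forall>e\<in>E. c e \<le> k) \<and> cf_connected_on (A \<union> B) E c"
proof -
  define c where "c e = (if e \<subseteq> A then cA e else if e \<subseteq> B then cB e else k)" for e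
  have A: "c e = cA e" if "e \<subseteq> A" for e using that by (simp add: c_def)
  have B: "c e = cB e" if "e \<in> E" "e \<subseteq> B" for e
  proof -
    have "e \<noteq> {}" using E[OF that(1)] by auto
    then have "\<not> e \<subseteq> A" using AB that(2) by blast
    then show ?thesis using that by (simp add: c_def)
  qed
  have f: "c {x, y} = k" using xy AB by (auto simp: c_def)
  have le: "\<forall>e\<in>E. c e \<le> k"
    using cA(1) cB(1) by (auto simp: c_def intro: less_imp_le)
  have across: "\<exists>p. path_in (A \<union> B) E u v p \<and> conflict_free_path c p" if uv: "u \<in> A" "v \<in> B" for u v
  proof -
    obtain p where p: "path_in A E u x p" using connected_on_path[OF conn(1) uv(1) xy(1)] .
    obtain q where q: "path_in B E y v q" using connected_on_path[OF conn(2) xy(2) uv(2)] .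
    have pq: "path_in (A \<union> B) E u v (p @ q)"
      using path_in_join(1)[OF p q AB _ _ order_refl xy(3), of "A \<union> B"] by simp
    have edges: "path_edges (p @ q) = insert {x, y} (path_edges p \<union> path_edges q)"
      using path_in_join(2)[OF p q AB _ _ order_refl xy(3), of "A \<union> B"] by simp
    have "conflict_free_path c (p @ q)"
    proof (rule conflict_free_pathI[of "{x, y}"])
      show "{x, y} \<in> path_edges (p @ q)" using edges by simp
      fix g assume g: "g \<in> path_edges (p @ q)" "c g = c {x, y}"
      have "g \<notin> path_edges p"
      proof
        assume "g \<in> path_edges p"
        from path_in_edges[OF p this] have "c g < k" using A[of g] cA(1)[of g] by simp
        then show False using g(2) f by simp
      qed
      moreover have "g \<notin> path_edges q"
      proof
        assume "g \<in> path_edges q"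
        from path_in_edges[OF q this] have "c g < k" using B[of g] cB(1)[of g] by simp
        then show False using g(2) f by simp
      qed
      ultimately show "g = {x, y}" using g(1) edges by blast
    qed
    then show ?thesis using pq by blast
  qed
  have "\<exists>p. path_in (A \<union> B) E u v p \<and> conflict_free_path c p"
    if uv: "u \<in> A \<union> B" "v \<in> A \<union> B" "u \<noteq> v" for u v
  proof -
    consider "u \<in> A" "v \<in> A" | "u \<in> B" "v \<in> B" | "u \<in> A" "v \<in> B" | "v \<in> A" "u \<in> B"
      using uv by blast
    then show ?thesis
    proof cases
      case 1
      then obtain p where p: "path_in A E u v p" "conflict_free_path cA p"
        using cA(2) uv(3) unfolding cf_connected_on_def by blast
      have "conflict_free_path c p"
        using p(2) conflict_free_path_cong[of p c cA] path_in_edges[OF p(1)] A by simp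
      moreover have "path_in (A \<union> B) E u v p" using path_in_mono[OF p(1)] by blast
      ultimately show ?thesis by blast
    next
      case 2
      then obtain p where p: "path_in B E u v p" "conflict_free_path cB p"
        using cB(2) uv(3) unfolding cf_connected_on_def by blast
      have "conflict_free_path c p"
        using p(2) conflict_free_path_cong[of p c cB] path_in_edges[OF p(1)] B by simp
      moreover have "path_in (A \<union> B) E u v p" using path_in_mono[OF p(1)] by blast
      ultimately show ?thesis by blast
    next
      case 3
      then show ?thesis using across by blast
    next
      case 4
      then obtain p where p: "path_in (A \<union> B) E v u p" "conflict_free_path c p"
        using across by blast
      then show ?thesis using path_in_rev[OF p(1)] conflict_free_path_rev[of c p] by blast
    qed
  qed
  then have "cf_connected_on (A \<union> B) E c" unfolding cf_connected_on_def by blast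
  then show ?thesis using le by blast
qed

section \<open>The induction that bounds the colors by the independence number\<close>

lemma connected_on_restrict:
  "connected_on W E \<longleftrightarrow> connected_on W {e \<in> E. e \<subseteq> W}"
proof -
  have "{(x, y). x \<in> W \<and> y \<in> W \<and> {x, y} \<in> E}
      = {(x, y). x \<in> W \<and> y \<in> W \<and> {x, y} \<in> {e \<in> E. e \<subseteq> W}}" by auto
  then show ?thesis by (simp add: connected_on_def reaches_def)
qed

text \<open>Every step from a vertex of \<open>e\<close> must use \<open>e\<close> itself, the only
  edge at that vertex, so a walk starting in \<open>e\<close> never leaves it.\<close>

lemma adjacent_leaves:
  assumes conn: "connected_on W F" and e: "e \<in> F" "e \<subseteq> leaves W F" "e \<noteq> {}"
  shows "W \<subseteq> e"
proof
  fix z assume z: "z \<in> W"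
  obtain x where x: "x \<in> e" using e by blast
  then have "x \<in> W" using e by (auto simp: leaves_def)
  then have "reaches W F x z" using conn z by (auto simp: connected_on_def)
  then show "z \<in> e"
  proof (induction rule: reaches_induct)
    case base
    show ?case using x .
  next
    case (step a b)
    then have "{a, b} = e" using leaf_edge_unique[of a W F "{a, b}" e] e by blast
    then show ?case by blast
  qed
qed

text \<open>Bounding the color values, and not just their number, makes the induction work: the
  colorings of the two sides of a bridge then avoid one common color that is still below the bound
  for \<open>W\<close>.\<close>

lemma cf_coloring_alpha:
  assumes "finite W" "connected_on W E" and E: "\<And>e. e \<in> E \<Longrightarrow> card e = 2"
  shows "\<exists>c. (\<forall>e\<in>E. e \<subseteq> W \<longrightarrow> c e < alpha W E) \<and> cf_connected_on W E c"
  using assms(1,2)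
proof (induction W rule: finite_psubset_induct)
  case (psubset W)
  define F where "F = {e \<in> E. e \<subseteq> W}"
  have connF: "connected_on W F" using psubset.prems connected_on_restrict[of W E] by (simp add: F_def)
  consider (split) A B f where "A \<union> B = W" "A \<inter> B = {}" "f \<in> F" "f \<inter> A \<noteq> {}" "f \<inter> B \<noteq> {}"
      "\<forall>e\<in>F. e \<inter> A \<noteq> {} \<longrightarrow> e \<inter> B \<noteq> {} \<longrightarrow> e = f" "\<not> (\<exists>x. A = {x} \<or> B = {x})"
    | (complete) "alpha W E \<le> 1"
    | (pendant) "alpha W E \<ge> 2" "bridges_pendant W F"
    unfolding bridges_pendant_def by (metis not_less_eq_eq One_nat_def Suc_1)
  then show ?case
  proof cases
    case split
    have "card f = 2" using split(3) E by (simp add: F_def)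
    then obtain a b where "f = {a, b}" by (auto simp: card_2_iff)
    then obtain x y where xy: "f = {x, y}" "x \<in> A" "y \<in> B"
      using split(2,4,5) by blast
    have "f \<inter> A = {x}" "f \<inter> B = {y}" using xy split(2) by auto
    then have one: "e \<inter> A = {x}" "e \<inter> B = {y}"
      if "e \<in> E" "e \<subseteq> W" "e \<inter> A \<noteq> {}" "e \<inter> B \<noteq> {}" for e
      using split(6) that by (auto simp: F_def)
    have A: "connected_on A E"
      using connected_on_side[OF psubset.prems split(1,2) xy(2)] one(1) by blast
    have BA: "B \<union> A = W" "B \<inter> A = {}" using split(1,2) by auto
    have B: "connected_on B E"
      using connected_on_side[OF psubset.prems BA xy(3)] one(2) by blast
    obtain z where z: "z \<in> B" "z \<noteq> y" using split(7) xy by blast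
    obtain z' where z': "z' \<in> A" "z' \<noteq> x" using split(7) xy by blast
    have less: "alpha A E < alpha W E" "alpha B E < alpha W E"
      by (rule alpha_side[OF psubset.hyps split(1,2) E one(2) z]
          alpha_side[OF psubset.hyps BA E one(1) z']; assumption)+
    have "A \<subset> W" "B \<subset> W" using split(1,2) xy by auto
    then obtain cA cB
      where cA: "\<forall>e\<in>E. e \<subseteq> A \<longrightarrow> cA e < alpha A E" "cf_connected_on A E cA"
        and cB: "\<forall>e\<in>E. e \<subseteq> B \<longrightarrow> cB e < alpha B E" "cf_connected_on B E cB"
      using psubset.IH[OF _ A] psubset.IH[OF _ B] by auto
    \<comment> \<open>The color \<open>k\<close>, one less than \<open>alpha W E\<close>, is the
      fresh one: both sides have independence number at most \<open>k\<close> and so use colors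
      below \<open>k\<close>.\<close>
    obtain k where k: "alpha W E = Suc k" using less by (cases "alpha W E") auto
    have f: "{x, y} \<in> E" using split(3) xy(1) by (simp add: F_def)
    have "cA e < k" if "e \<in> E" "e \<subseteq> A" for e using cA(1) less k that by force
    moreover have "cB e < k" if "e \<in> E" "e \<subseteq> B" for e using cB(1) less k that by force
    ultimately have "\<exists>c. (\<forall>e\<in>E. c e \<le> k) \<and> cf_connected_on (A \<union> B) E c"
      using cf_coloring_glue[OF split(2) E xy(2,3) f A B _ cA(2) _ cB(2), of k] by simp
    then obtain c where "\<forall>e\<in>E. c e \<le> k" "cf_connected_on W E c" using split(1) by blast
    then show ?thesis using k by (auto simp: less_Suc_eq_le)
  next
    case complete
    \<comment> \<open>Color 0 has to lie below the bound, which for empty \<open>W\<close> is 0;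
      hence positivity is derived from the presence of an edge.\<close>
    have "0 < alpha W E" if e: "e \<in> E" "e \<subseteq> W" for e
    proof -
      obtain a where a: "a \<in> e" using E[OF e(1)] by fastforce
      have "\<not> e' \<subseteq> {a}" if "e' \<in> E" for e' using E[OF that] by (auto simp: subset_singleton_iff)
      then have "card {a} \<le> alpha W E" using a e psubset.hyps by (intro card_le_alpha) auto
      then show ?thesis by simp
    qed
    moreover have "cf_connected_on W E (\<lambda>_. 0)"
      unfolding cf_connected_on_def
    proof (intro ballI impI)
      fix u v assume uv: "u \<in> W" "v \<in> W" "u \<noteq> v"
      then have "path_in W E u v [u, v]"
        using complete alpha_le_one_iff[OF psubset.hyps E] by (auto simp: path_in_def)
      moreover have "conflict_free_path (\<lambda>_. 0) [u, v]" by (rule conflict_free_pathI[of "{u, v}"]) auto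
      ultimately show "\<exists>p. path_in W E u v p \<and> conflict_free_path (\<lambda>_. 0) p" by blast
    qed
    ultimately show ?thesis by (intro exI[of _ "\<lambda>_. 0"]) blast
  next
    case pendant
    let ?L = "leaves W F"
    have wf: "e \<subseteq> W \<and> card e = 2" if "e \<in> F" for e using that E by (simp add: F_def)
    have indep: "\<not> e \<subseteq> ?L" if e: "e \<in> F" for e
    proof
      assume "e \<subseteq> ?L"
      moreover have "e \<noteq> {}" using wf[OF e] by auto
      \<comment> \<open>Two adjacent leaves would make the whole graph a single edge. An independent
        set of size at least 2 would then be all of \<open>W\<close> and contain that edge.\<close>
      ultimately have We: "W = e" using adjacent_leaves[OF connF e] wf[OF e] by blast
      obtain S where S: "S \<subseteq> W" "\<forall>e\<in>E. \<not> e \<subseteq> S" "card S = alpha W E"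
        using alpha_attained[OF psubset.hyps E] .
      then have "card W \<le> card S" using pendant(1) wf[OF e] We by simp
      then have "S = W" using card_seteq[OF psubset.hyps S(1)] by simp
      then show False using S(2) e We by (auto simp: F_def)
    qed
    have LW: "?L \<subseteq> W" by (auto simp: leaves_def)
    \<comment> \<open>The leaves themselves form an independent set.\<close>
    then have "card ?L \<le> alpha W E"
      using psubset.hyps indep by (intro card_le_alpha) (auto simp: F_def)
    then have max: "max 2 (card ?L) \<le> alpha W E" using pendant(1) by simp
    have "\<exists>c. (\<forall>e\<in>F. c e < max 2 (card ?L)) \<and> cf_connected_on W F c"
      by (rule cf_coloring_pendant_bridges[OF psubset.hyps connF wf pendant(2) indep])
    then obtain c where c: "\<forall>e\<in>F. c e < max 2 (card ?L)" "cf_connected_on W F c" by blast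
    have "c e < alpha W E" if "e \<in> E" "e \<subseteq> W" for e
      using c(1) that max by (force simp: F_def)
    moreover have "path_in W E u v p" if "path_in W F u v p" for u v p
      by (rule path_in_mono[OF that]) (auto simp: F_def)
    then have "cf_connected_on W E c"
      using c(2) unfolding cf_connected_on_def by blast
    ultimately show ?thesis by blast
  qed
qed

section \<open>Translation between digraph notions and sets of edges\<close>

lemma doubleton_edges_iff:
  assumes "pair_graph G"
  shows "{u, v} \<in> edges G \<longleftrightarrow> (u, v) \<in> parcs G"
proof -
  interpret pair_graph G by fact
  have "(u, v) \<in> parcs G \<longleftrightarrow> (v, u) \<in> parcs G"
    using arcs_ends_symmetric[OF pair_sym_arcs] by auto
  moreover have "{u, v} \<in> edges G \<longleftrightarrow> (u, v) \<in> parcs G \<or> (v, u) \<in> parcs G"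
    by (force simp: edges_def edge_of_def image_iff doubleton_eq_iff)
  ultimately show ?thesis by blast
qed

lemma edges_wf:
  assumes "pair_graph G" "e \<in> edges G"
  shows "e \<subseteq> pverts G" "card e = 2"
proof -
  interpret pair_graph G by fact
  obtain a where a: "a \<in> parcs G" "e = {fst a, snd a}"
    using assms(2) by (auto simp: edges_def edge_of_def)
  then show "e \<subseteq> pverts G" using arc_fst_in_verts arc_snd_in_verts by auto
  show "card e = 2" using a pair_no_loops[of a] by simp
qed

lemma vpath_iff_path_in:
  assumes "pair_graph G"
  shows "vpath p (with_proj G) \<and> hd p = u \<and> last p = v \<longleftrightarrow> path_in (pverts G) (edges G) u v p"
proof -
  have "edge_of a \<in> edges G \<longleftrightarrow> a \<in> parcs G" for a
    using doubleton_edges_iff[OF assms, of "fst a" "snd a"] by (simp add: edge_of_def)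
  then have "path_edges p \<subseteq> edges G \<longleftrightarrow> set (vwalk_arcs p) \<subseteq> parcs G"
    by (auto simp: path_edges_def)
  then show ?thesis by (auto simp: vpath_def vwalk_def path_in_def)
qed

lemma conflict_free_connected_iff:
  assumes "pair_graph G"
  shows "conflict_free_connected G c \<longleftrightarrow> cf_connected_on (pverts G) (edges G) c"
  unfolding conflict_free_connected_def cf_connected_on_def
  by (simp flip: vpath_iff_path_in[OF assms] add: conj_assoc)

lemma independence_number_eq_alpha:
  assumes "pair_graph G"
  shows "independence_number G = alpha (pverts G) (edges G)"
proof -
  interpret pair_graph G by fact
  have "pairwise (\<lambda>u v. (u, v) \<notin> parcs G) S \<longleftrightarrow> (\<forall>e\<in>edges G. \<not> e \<subseteq> S)" for S
    unfolding pairwise_def edges_def edge_of_def using pair_no_loops by fastforce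
  then show ?thesis by (simp add: independence_number_def alpha_def independent_set_def)
qed

text \<open>Connectedness is strong connectedness of the symmetric closure; the arcs are already
  symmetric, so reachability in the closure is reachability in \<open>G\<close>.\<close>

lemma connected_on_pverts:
  assumes "pair_graph G" "connected (with_proj G)"
  shows "connected_on (pverts G) (edges G)"
  unfolding connected_on_def
proof (intro ballI)
  interpret pair_graph G by fact
  fix u v assume "u \<in> pverts G" "v \<in> pverts G"
  then have "u \<rightarrow>\<^sup>*\<^bsub>with_proj (mk_symmetric (with_proj G))\<^esub> v"
    using assms(2) unfolding connected_def strongly_connected_def by simp
  then have "u \<rightarrow>\<^sup>*\<^bsub>with_proj G\<^esub> v"
    using reachable_mk_symmetric_eq pair_sym_arcs by blast
  then have "(u, v) \<in> (parcs G)\<^sup>*" using reachable_rtranclI by fastforce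
  then show "reaches (pverts G) (edges G) u v"
    unfolding reaches_def
  proof (rule rtrancl_mono[THEN subsetD, rotated])
    show "parcs G \<subseteq> {(x, y). x \<in> pverts G \<and> y \<in> pverts G \<and> {x, y} \<in> edges G}"
      using doubleton_edges_iff[OF assms(1)] in_arcsD1 in_arcsD2 by auto
  qed
qed

section \<open>The extremal values of the conflict-free connection number\<close>

lemma cfc_attained:
  assumes "conflict_free_connected G c"
  obtains c' where "conflict_free_connected G c'" "card (c' ` edges G) = cfc G"
proof -
  have "\<exists>k c. conflict_free_connected G c \<and> card (c ` edges G) = k" using assms by blast
  from LeastI_ex[OF this] show thesis using that unfolding cfc_def by (elim exE conjE)
qed

lemma cfc_le: "conflict_free_connected G c \<Longrightarrow> cfc G \<le> card (c ` edges G)"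
  unfolding cfc_def by (rule Least_le) blast

lemma conflict_free_path_unique:
  assumes "conflict_free_path c p"
  obtains e where "e \<in> path_edges p" "\<forall>g\<in>path_edges p. c g = c e \<longrightarrow> g = e"
  using assms unfolding conflict_free_path_def by metis

text \<open>Separates single edges from longer paths; in the latter the first two edges are exposed
  and \<open>w\<close> is a genuine interior vertex.\<close>

lemma path_in_cases:
  assumes "path_in W E u v p" "u \<noteq> v"
  obtains "p = [u, v]" | w z q where "p = u # w # z # q" "w \<noteq> v"
proof -
  obtain w q where p: "p = u # w # q"
    using assms by (cases p; cases "tl p") (auto simp: path_in_def)
  show thesis
  proof (cases q)
    case Nil
    then show thesis using assms(1) p that(1) by (simp add: path_in_def)
  next
    case (Cons z q')
    then have "v \<in> set (z # q')" "w \<notin> set (z # q')"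
      using assms(1) p by (auto simp: path_in_def)
    then have "w \<noteq> v" by blast
    then show thesis using that(2) p Cons by simp
  qed
qed

text \<open>With a single color, a conflict-free path can have only one edge, so its ends are
  adjacent.\<close>

lemma monochromatic_cf_connected_complete:
  assumes "cf_connected_on W E c" "card (c ` E) = 1" "u \<in> W" "v \<in> W" "u \<noteq> v"
  shows "{u, v} \<in> E"
proof -
  obtain k where k: "c ` E = {k}" using assms(2) by (auto simp: card_1_singleton_iff)
  obtain p where p: "path_in W E u v p" "conflict_free_path c p"
    using assms unfolding cf_connected_on_def by blast
  obtain e where e: "e \<in> path_edges p" "\<forall>g\<in>path_edges p. c g = c e \<longrightarrow> g = e"
    using conflict_free_path_unique[OF p(2)] .
  have sub: "path_edges p \<subseteq> E" using p(1) by (auto simp: path_in_def)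
  then have "c g = k" if "g \<in> path_edges p" for g using k that by blast
  then have single: "g = e" if "g \<in> path_edges p" for g using e that by metis
  from path_in_cases[OF p(1) assms(5)] show ?thesis
  proof cases
    case 1
    then show ?thesis using sub by simp
  next
    case (2 w z q)
    then have "{u, w} = {w, z}" using single[of "{u, w}"] single[of "{w, z}"] by simp
    moreover have "distinct [u, w, z]" using p(1) 2 by (auto simp: path_in_def)
    ultimately show ?thesis by (auto simp: doubleton_eq_iff)
  qed
qed

text \<open>Removing \<open>x\<close> leaves an independent set, so the connected graph is a star
  with center \<open>x\<close>. The only path between two of its leaves has two edges, and these
  must differ in color.\<close>

lemma star_colors:
  assumes W: "W = insert x S" "x \<notin> S" "finite S" and E: "finite E" "\<And>e. e \<in> E \<Longrightarrow> card e = 2"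
    and S: "\<forall>e\<in>E. \<not> e \<subseteq> S" and conn: "connected_on W E" and c: "cf_connected_on W E c"
  shows "card S \<le> card (c ` E)"
proof -
  have to_center: "b = x" if "{a, b} \<in> E" "a \<in> S" "b \<in> W" for a b
    using S W that by auto
  have edge: "{s, x} \<in> E" if s: "s \<in> S" for s
  proof -
    have sx: "s \<in> W" "x \<in> W" "s \<noteq> x" using s W by auto
    obtain p where p: "path_in W E s x p" using connected_on_path[OF conn sx(1,2)] .
    from path_in_cases[OF p sx(3)] show ?thesis
    proof cases
      case 1
      then show ?thesis using p by (auto simp: path_in_def)
    next
      case (2 w z q)
      then have "{s, w} \<in> E" "w \<in> W" using p by (auto simp: path_in_def)
      then show ?thesis using to_center[of s w] s 2 by blast
    qed
  qed
  have "inj_on (\<lambda>s. c {s, x}) S"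
  proof (rule inj_onI, rule ccontr)
    fix s t assume st: "s \<in> S" "t \<in> S" "c {s, x} = c {t, x}" "s \<noteq> t"
    then have "s \<in> W" "t \<in> W" using W by auto
    then obtain p where p: "path_in W E s t p" "conflict_free_path c p"
      using c st(4) unfolding cf_connected_on_def by blast
    obtain e where e: "e \<in> path_edges p" "\<forall>g\<in>path_edges p. c g = c e \<longrightarrow> g = e"
      using conflict_free_path_unique[OF p(2)] .
    from path_in_cases[OF p(1) st(4)] show False
    proof cases
      case 1
      then have "{s, t} \<in> E" using p by (auto simp: path_in_def)
      then show False using S st by auto
    next
      case (2 w z q)
      then have w: "{s, w} \<in> E" "w \<in> W" "z \<in> W" "{w, z} \<in> E" "w \<noteq> z" "z \<noteq> s"
        using p(1) by (auto simp: path_in_def)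
      then have "w = x" using to_center st(1) by blast
      then have "z \<in> S" using w W by auto
      \<comment> \<open>From \<open>z\<close> in the independent set \<open>S\<close> the path could
        continue only to \<open>x\<close>, which it has already visited.\<close>
      have "q = []"
      proof (cases q)
        case (Cons y q')
        then have "{z, y} \<in> E" "y \<in> W" "y \<noteq> w" using p(1) 2 by (auto simp: path_in_def)
        then show ?thesis using to_center \<open>z \<in> S\<close> \<open>w = x\<close> by blast
      qed
      then have "path_edges p = {{s, x}, {t, x}}" and "{s, x} \<noteq> {t, x}"
        using 2 p(1) \<open>w = x\<close> st(4) by (auto simp: path_in_def insert_commute doubleton_eq_iff)
      then show False using e st(3) by (metis insertCI insertE singletonD)
    qed
  qed
  then have "card S = card ((\<lambda>s. c {s, x}) ` S)" by (simp add: card_image)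
  also have "\<dots> \<le> card (c ` E)" using edge E(1) by (intro card_mono) auto
  finally show ?thesis .
qed

theorem theorem1:
  fixes G :: "'a pair_pre_digraph" and n :: nat
  assumes "pair_graph G"
    and "connected (with_proj G)"
    and "card (pverts G) = n"
    and "n \<ge> 2"
  shows "1 \<le> cfc G \<and> cfc G \<le> independence_number G \<and> independence_number G \<le> n - 1
    \<and> (cfc G = 1 \<longleftrightarrow> independence_number G = 1)
    \<and> (cfc G = n - 1 \<longleftrightarrow> independence_number G = n - 1)"
proof -
  interpret pair_graph G by fact
  define W where "W = pverts G"
  define E where "E = edges G"
  have W: "finite W" "card W = n" using pair_finite_verts assms(3) by (simp_all add: W_def)
  have finE: "finite E" using pair_finite_arcs by (simp add: E_def edges_def)
  have wf: "e \<subseteq> W" "card e = 2" if "e \<in> E" for e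
    using edges_wf[OF assms(1)] that by (simp_all add: E_def W_def)
  have conn: "connected_on W E" using connected_on_pverts assms(1,2) by (simp add: W_def E_def)
  have cf_iff: "conflict_free_connected G c \<longleftrightarrow> cf_connected_on W E c" for c
    using conflict_free_connected_iff[OF assms(1)] by (simp add: W_def E_def)
  have ind: "independence_number G = alpha W E"
    using independence_number_eq_alpha[OF assms(1)] by (simp add: W_def E_def)
  have "\<not> card W \<le> Suc 0" using W(2) assms(4) by simp
  then obtain u v where uv: "u \<in> W" "v \<in> W" "u \<noteq> v"
    using card_le_Suc0_iff_eq[OF W(1)] by blast

  obtain c where c: "\<forall>e\<in>E. e \<subseteq> W \<longrightarrow> c e < alpha W E" "cf_connected_on W E c"
    using cf_coloring_alpha[OF W(1) conn wf(2)] by blast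
  have "c ` E \<subseteq> {..<alpha W E}" using c(1) wf(1) by auto
  then have "card (c ` E) \<le> alpha W E" using card_mono[of "{..<alpha W E}"] by simp
  then have upper: "cfc G \<le> alpha W E"
    using cfc_le[of G c] cf_iff c(2) by (simp add: E_def)
  have "conflict_free_connected G c" using cf_iff c(2) by simp
  then obtain c0 where "conflict_free_connected G c0" "card (c0 ` edges G) = cfc G"
    by (rule cfc_attained)
  then have c0: "cf_connected_on W E c0" "card (c0 ` E) = cfc G"
    using cf_iff by (simp_all add: E_def)

  obtain p where p: "path_in W E u v p" using connected_on_path[OF conn uv(1,2)] .
  from path_in_cases[OF p uv(3)] have "E \<noteq> {}"
    by cases (use p in \<open>auto simp: path_in_def\<close>)
  then have "card (c0 ` E) \<noteq> 0" using finE by simp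
  then have lower: "1 \<le> cfc G" using c0(2) by simp

  obtain S where S: "S \<subseteq> W" "\<forall>e\<in>E. \<not> e \<subseteq> S" "card S = alpha W E"
    using alpha_attained[OF W(1) wf(2)] .
  have "S \<noteq> W" using S(2) \<open>E \<noteq> {}\<close> wf(1) by blast
  then have "card S < n" using psubset_card_mono[OF W(1), of S] S(1) W(2) by blast
  then have le: "alpha W E \<le> n - 1" using S(3) by simp

  \<comment> \<open>These two implications suffice. The converse ones follow by squeezing
    \<open>cfc G\<close> between 1 and \<open>alpha W E\<close>, and \<open>alpha W E\<close>
    between \<open>cfc G\<close> and \<open>n - 1\<close>.\<close>
  have "alpha W E = 1" if "cfc G = 1"
  proof -
    have "alpha W E \<le> 1"
      using monochromatic_cf_connected_complete[OF c0(1)] c0(2) that alpha_le_one_iff[OF W(1) wf(2)]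
      by simp
    then show ?thesis using upper lower by simp
  qed
  moreover have "n - 1 \<le> cfc G" if "alpha W E = n - 1"
  proof -
    have "card (W - S) = 1"
      using that S W assms(4) by (simp add: card_Diff_subset finite_subset)
    then obtain x where "W - S = {x}" by (auto simp: card_1_singleton_iff)
    then have "W = insert x S" "x \<notin> S" using S(1) by auto
    then have "card S \<le> card (c0 ` E)"
      using star_colors[OF _ _ _ finE wf(2) S(2) conn c0(1)] finite_subset[OF S(1) W(1)] by blast
    then show ?thesis using that S(3) c0(2) by simp
  qed
  ultimately show ?thesis using upper lower le unfolding ind by force
qed

end
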